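(* Let $\mathcal{G}(G,w,C,\beta)$ be a coordination game on a weighted directed graph $(G,w)$ with colour assignment $C$ and bonus function $\beta$. Let $s$ be a Nash equilibrium of this game, let $K$ be a coalition, and let $s'$ be a profitable deviation of the players in $K$ from $s$. Then there is a directed simple cycle in $G$ all of whose nodes belong to $K$ and all of whose nodes have the same colour in $s'$ (i.e. any profitable coalition deviation from a Nash equilibrium includes a unicoloured directed simple cycle).
   Context: Coordination game: let $M$ be a finite set of colours and $G=(V,E)$ a finite directed graph without self-loops, with at least two nodes. Each edge $e\in E$ has a non-negative weight $w_e$. The set of neighbours of $i$ is $N_i=\{j\in V : (j\to i)\in E\}$. A colour assignment $C$ gives each node $i$ a non-empty set $C(i)\subseteq M$. A bonus function $\beta$ gives a natural number (possibly $0$) $\beta(i,c)$ for each node $i$ and colour $c$. The players of $\mathcal{G}(G,w,C,\beta)$ are the nodes; the strategy set of player $i$ is $C(i)$; the payoff of $i$ in a joint strategy $s=(s_j)_{j\in V}$ is $p_i(s)=\sum_{j\in N_i,\ s_j=s_i} w_{j\to i}+\beta(i,s_i)$. A coalition is a non-empty set of players. A joint strategy $s'$ is a deviation of the players in $K$ from $s$ if $K=\{i : s_i\neq s'_i\}$; it is profitable if $p_i(s')>p_i(s)$ for all $i\in K$. A Nash equilibrium is a joint strategy from which no coalition of size one has a profitable deviation. *)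

theory Defs
  imports Complex_Main "HOL-Library.FuncSet" "Graph_Theory.Graph_Theory"
begin

text \<open>An arc \<open>(j, i)\<close> of a pair digraph is the edge \<open>j \<rightarrow> i\<close>; the locale
  \<open>pair_digraph\<close> requires finiteness and the absence of loops. The bonus function is an arbitrary
  function to \<open>nat\<close>, subject to no condition, so it is not a parameter of the locale.\<close>

locale coordination_game = pair_digraph G
  for G :: "'v pair_pre_digraph" +
  fixes M :: "'c set"
    and w :: "'v \<times> 'v \<Rightarrow> real"
    and C :: "'v \<Rightarrow> 'c set"
  assumes two_nodes: "2 \<le> card (pverts G)"
    and finite_colours: "finite M"
    and weight_nonneg: "e \<in> parcs G \<Longrightarrow> 0 \<le> w e"
    and colours_subset: "i \<in> pverts G \<Longrightarrow> C i \<subseteq> M"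
    and colours_nonempty: "i \<in> pverts G \<Longrightarrow> C i \<noteq> {}"

definition neighbours :: "'v pair_pre_digraph \<Rightarrow> 'v \<Rightarrow> 'v set" where
  "neighbours G i = {j \<in> pverts G. (j, i) \<in> parcs G}"

text \<open>Joint strategies are extensional, so two of them are equal iff they agree on all nodes.\<close>

definition joint_strategies :: "'v pair_pre_digraph \<Rightarrow> ('v \<Rightarrow> 'c set) \<Rightarrow> ('v \<Rightarrow> 'c) set" where
  "joint_strategies G C = (\<Pi>\<^sub>E i \<in> pverts G. C i)"

definition payoff ::
  "'v pair_pre_digraph \<Rightarrow> ('v \<times> 'v \<Rightarrow> real) \<Rightarrow> ('v \<Rightarrow> 'c \<Rightarrow> nat) \<Rightarrow> 'v \<Rightarrow> ('v \<Rightarrow> 'c) \<Rightarrow> real" where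
  "payoff G w \<beta> i s =
     (\<Sum>j \<in> {j \<in> neighbours G i. s j = s i}. w (j, i)) + real (\<beta> i (s i))"

definition coalition :: "'v pair_pre_digraph \<Rightarrow> 'v set \<Rightarrow> bool" where
  "coalition G K \<longleftrightarrow> K \<subseteq> pverts G \<and> K \<noteq> {}"

definition deviation ::
  "'v pair_pre_digraph \<Rightarrow> ('v \<Rightarrow> 'c set) \<Rightarrow> 'v set \<Rightarrow> ('v \<Rightarrow> 'c) \<Rightarrow> ('v \<Rightarrow> 'c) \<Rightarrow> bool" where
  "deviation G C K s s' \<longleftrightarrow>
     s \<in> joint_strategies G C \<and> s' \<in> joint_strategies G C \<and>
     K = {i \<in> pverts G. s i \<noteq> s' i}"

definition profitable_deviation ::
  "'v pair_pre_digraph \<Rightarrow> ('v \<times> 'v \<Rightarrow> real) \<Rightarrow> ('v \<Rightarrow> 'c set) \<Rightarrow> ('v \<Rightarrow> 'c \<Rightarrow> nat) \<Rightarrow>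
   'v set \<Rightarrow> ('v \<Rightarrow> 'c) \<Rightarrow> ('v \<Rightarrow> 'c) \<Rightarrow> bool" where
  "profitable_deviation G w C \<beta> K s s' \<longleftrightarrow>
     deviation G C K s s' \<and> (\<forall>i \<in> K. payoff G w \<beta> i s' > payoff G w \<beta> i s)"

definition nash_equilibrium ::
  "'v pair_pre_digraph \<Rightarrow> ('v \<times> 'v \<Rightarrow> real) \<Rightarrow> ('v \<Rightarrow> 'c set) \<Rightarrow> ('v \<Rightarrow> 'c \<Rightarrow> nat) \<Rightarrow>
   ('v \<Rightarrow> 'c) \<Rightarrow> bool" where
  "nash_equilibrium G w C \<beta> s \<longleftrightarrow>
     s \<in> joint_strategies G C \<and>
     \<not> (\<exists>K s'. coalition G K \<and> card K = 1 \<and> profitable_deviation G w C \<beta> K s s')"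

text \<open>The nodes visited by a non-empty sequence of arcs.\<close>

definition walk_nodes :: "('v \<times> 'v) list \<Rightarrow> 'v set" where
  "walk_nodes p = fst ` set p \<union> snd ` set p"

end

theory Submission
  imports Defs
begin

text \<open>If some player \<open>i\<close> of the coalition had no in-neighbour in the coalition sharing its new
  colour, then moving alone to that colour would pay \<open>i\<close> at least as much as the joint deviation, as
  all neighbours that support \<open>i\<close> in \<open>s'\<close> already have their colour in \<open>s\<close>. So every player of
  the coalition has such an in-neighbour, and following these backwards in a finite set closes a
  cycle.\<close>

lemma (in coordination_game) ex_unicoloured_predecessor:
  assumes nash: "nash_equilibrium G w C \<beta> s"
    and dev: "profitable_deviation G w C \<beta> K s s'"
    and i: "i \<in> K"
  shows "\<exists>j \<in> K. (j, i) \<in> parcs G \<and> s' j = s' i"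
proof (rule ccontr)
  assume no_pred: "\<not> ?thesis"
  define t where "t = s(i := s' i)"
  have K: "K = {i \<in> pverts G. s i \<noteq> s' i}"
    and s: "s \<in> joint_strategies G C" and s': "s' \<in> joint_strategies G C"
    and gain: "payoff G w \<beta> i s < payoff G w \<beta> i s'"
    using dev i by (auto simp: profitable_deviation_def deviation_def)
  have i_vert: "i \<in> pverts G" and i_moves: "s i \<noteq> s' i"
    using i K by auto
  have t: "t \<in> joint_strategies G C"
    using s s' i_vert by (auto simp: t_def joint_strategies_def PiE_iff extensional_def)
  have fin: "finite (neighbours G i)"
    using pair_finite_verts by (simp add: neighbours_def)
  \<comment> \<open>Such a \<open>j\<close> lies outside \<open>K\<close> by \<open>no_pred\<close>,
    so its colour is the same in \<open>s\<close>. It differs from \<open>i\<close>, which is in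
    \<open>K\<close>; hence passing from \<open>s\<close> to \<open>t\<close> leaves its colour
    alone.\<close>
  have "s j = s' j" "j \<noteq> i" if "j \<in> neighbours G i" "s' j = s' i" for j
    using that no_pred K i by (auto simp: neighbours_def)
  then have "{j \<in> neighbours G i. s' j = s' i} \<subseteq> {j \<in> neighbours G i. t j = t i}"
    by (auto simp: t_def)
  \<comment> \<open>The inclusion can be strict: coalition members that abandon the colour
    \<open>s' i\<close> still support \<open>i\<close> in \<open>t\<close>. Non-negative weights
    make these extra terms harmless.\<close>
  then have "(\<Sum>j \<in> {j \<in> neighbours G i. s' j = s' i}. w (j, i))
      \<le> (\<Sum>j \<in> {j \<in> neighbours G i. t j = t i}. w (j, i))"
    using fin by (intro sum_mono2) (auto simp: neighbours_def weight_nonneg)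
  \<comment> \<open>The bonuses cancel because \<open>t i = s' i\<close>.\<close>
  then have "payoff G w \<beta> i s' \<le> payoff G w \<beta> i t"
    by (simp add: payoff_def t_def)
  with gain have "payoff G w \<beta> i s < payoff G w \<beta> i t"
    by simp
  moreover have "{i} = {j \<in> pverts G. s j \<noteq> t j}"
    using i_vert i_moves by (auto simp: t_def)
  ultimately have "profitable_deviation G w C \<beta> {i} s t"
    using s t unfolding profitable_deviation_def deviation_def by (intro conjI ballI) auto
  moreover have "coalition G {i}"
    using i_vert by (simp add: coalition_def)
  ultimately show False
    using nash unfolding nash_equilibrium_def by (metis is_singletonI is_singleton_altdef)
qed

text \<open>A finite acyclic relation is well-founded, so \<open>K\<close> would have an
  \<open>R\<close>-minimal element, which cannot have a predecessor in \<open>K\<close>.\<close>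

lemma not_acyclic_if_predecessors:
  assumes "finite R" "K \<noteq> {}" "\<And>i. i \<in> K \<Longrightarrow> \<exists>j \<in> K. (j, i) \<in> R"
  shows "\<not> acyclic R"
proof
  assume "acyclic R"
  with \<open>finite R\<close> have "wf R"
    by (rule finite_acyclic_wf)
  moreover obtain x where "x \<in> K"
    using \<open>K \<noteq> {}\<close> by blast
  ultimately obtain z where "z \<in> K" "\<And>y. (y, z) \<in> R \<Longrightarrow> y \<notin> K"
    by (rule wfE_min) blast
  with assms(3) show False
    by blast
qed

lemma (in pair_wf_digraph) ex_cycle_if_not_acyclic:
  assumes "\<not> acyclic (parcs G)"
  shows "\<exists>p. cycle p"
proof -
  obtain x where "(x, x) \<in> (parcs G)\<^sup>+"
    using assms by (auto simp: acyclic_def)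
  then obtain p where "awalk x p x" "p \<noteq> []"
    using reachable1_awalk by auto
  then have "closed_w p"
    by (auto simp: closed_w_def)
  then show ?thesis
    by (rule closed_w_imp_cycle)
qed

text \<open>Consecutive arcs of a walk share a node, so equality across each arc propagates from
  \<open>u\<close> to every visited node. With \<open>f = s'\<close> this turns arcwise agreement
  into a single colour.\<close>

lemma pcas_constant:
  assumes "pcas u p v" "\<And>i j. (i, j) \<in> set p \<Longrightarrow> f i = f j" "x \<in> walk_nodes p"
  shows "f x = f u"
  using assms
proof (induction p arbitrary: u)
  case Nil
  then show ?case by (simp add: walk_nodes_def)
next
  case (Cons e p)
  obtain y where e: "e = (u, y)"
    using Cons.prems(1) by (cases e) auto
  have "f u = f y"
    using Cons.prems(2) e by simp
  moreover have "f x = f y" if "x \<in> walk_nodes p"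
    using Cons.IH[of y] Cons.prems(1,2) e that by simp
  moreover have "x = u \<or> x = y \<or> x \<in> walk_nodes p"
    using Cons.prems(3) e by (auto simp: walk_nodes_def)
  ultimately show ?case
    by auto
qed

theorem lemma2:
  fixes G :: "'v pair_pre_digraph"
    and M :: "'c set"
    and w :: "'v \<times> 'v \<Rightarrow> real"
    and C :: "'v \<Rightarrow> 'c set"
    and \<beta> :: "'v \<Rightarrow> 'c \<Rightarrow> nat"
    and s s' :: "'v \<Rightarrow> 'c"
    and K :: "'v set"
  assumes "coordination_game G M w C"
    and "nash_equilibrium G w C \<beta> s"
    and "coalition G K"
    and "profitable_deviation G w C \<beta> K s s'"
  shows "\<exists>p. pre_digraph.cycle (with_proj G) p \<and>
           walk_nodes p \<subseteq> K \<and>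
           (\<exists>c. \<forall>i \<in> walk_nodes p. s' i = c)"
proof -
  interpret coordination_game G M w C by fact
  \<comment> \<open>Both required properties are built into the arcs, so any cycle of the subgraph
    \<open>H\<close> will do.\<close>
  define R where "R = {(j, i) \<in> parcs G. j \<in> K \<and> i \<in> K \<and> s' j = s' i}"
  define H where "H = \<lparr>pverts = K, parcs = R\<rparr>"
  have K: "K \<subseteq> pverts G" "K \<noteq> {}"
    using assms(3) by (auto simp: coalition_def)
  interpret H: pair_wf_digraph H
    by unfold_locales (auto simp: H_def R_def)
  have "finite R"
    using pair_finite_arcs by (rule finite_subset[rotated]) (auto simp: R_def)
  moreover have "\<exists>j \<in> K. (j, i) \<in> R" if "i \<in> K" for i
    using ex_unicoloured_predecessor[OF assms(2,4) that] that by (auto simp: R_def)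
  ultimately have "\<not> acyclic (parcs H)"
    using K(2) not_acyclic_if_predecessors[of R K] by (simp add: H_def)
  then obtain p where p: "H.cycle p"
    using H.ex_cycle_if_not_acyclic by blast
  then obtain u where u: "H.awalk u p u"
    by (auto simp: H.cycle_def)
  then have "set p \<subseteq> parcs H" and cas: "pcas u p u"
    by (simp_all add: H.awalk_def)
  then have arcs: "set p \<subseteq> R"
    by (simp add: H_def)
  have "subgraph H G"
    using K(1) H.wf_digraph_axioms wf_digraph_axioms
    by (auto simp: subgraph_def compatible_def H_def R_def)
  then have "cycle p"
    using p by (rule subgraph_cycle)
  moreover have "walk_nodes p \<subseteq> K"
    using arcs by (auto simp: walk_nodes_def R_def)
  \<comment> \<open>The common colour is that of the node \<open>u\<close> where the closed walk
    starts.\<close>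
  moreover have "s' i = s' u" if "i \<in> walk_nodes p" for i
    using cas _ that by (rule pcas_constant) (use arcs in \<open>auto simp: R_def\<close>)
  ultimately show ?thesis
    by blast
qed

end
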